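(* Let $S$ be an intra-regular AG-groupoid with left identity and let $A=(\mu_A,\gamma_A)$ be an intuitionistic fuzzy set of $S$. Then the following conditions are equivalent: (i) $A$ is an intuitionistic fuzzy two-sided ideal of $S$; (ii) $A$ is an intuitionistic fuzzy $(1,2)$-ideal of $S$.
   Context: An AG-groupoid is a non-empty set $S$ with a binary operation satisfying the left invertive law $(ab)c=(cb)a$ for all $a,b,c\in S$ (no associativity is assumed); $a^2$ denotes $aa$. A left identity is an element $e\in S$ with $ea=a$ for all $a\in S$. $S$ is intra-regular if for every $a\in S$ there are $x,y\in S$ with $a=(xa^2)y$. An intuitionistic fuzzy set (IFS) of $S$ is a pair $A=(\mu_A,\gamma_A)$ of functions $\mu_A,\gamma_A:S\to[0,1]$ with $0\le \mu_A(x)+\gamma_A(x)\le 1$ for all $x\in S$. An IFS $A$ is an intuitionistic fuzzy left ideal if $\mu_A(xy)\ge\mu_A(y)$ and $\gamma_A(xy)\le\gamma_A(y)$ for all $x,y\in S$; an intuitionistic fuzzy right ideal if $\mu_A(xy)\ge\mu_A(x)$ and $\gamma_A(xy)\le\gamma_A(x)$ for all $x,y\in S$; an intuitionistic fuzzy two-sided ideal if it is both. It is an intuitionistic fuzzy AG-subgroupoid if $\mu_A(xy)\ge\min\{\mu_A(x),\mu_A(y)\}$ and $\gamma_A(xy)\le\max\{\gamma_A(x),\gamma_A(y)\}$ for all $x,y\in S$. An intuitionistic fuzzy $(1,2)$-ideal is an intuitionistic fuzzy AG-subgroupoid with $\mu_A((xw)(yz))\ge\min\{\mu_A(x),\mu_A(y),\mu_A(z)\}$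 and $\gamma_A((xw)(yz))\le\max\{\gamma_A(x),\gamma_A(y),\gamma_A(z)\}$ for all $x,w,y,z\in S$. *)

theory Defs
  imports Complex_Main
begin

locale ag_groupoid =
  fixes S :: "'a set" and f :: "'a \<Rightarrow> 'a \<Rightarrow> 'a"  (infixl "\<cdot>" 70)
  assumes nonempty: "S \<noteq> {}"
    and closed: "\<lbrakk>a \<in> S; b \<in> S\<rbrakk> \<Longrightarrow> a \<cdot> b \<in> S"
    and left_invertive: "\<lbrakk>a \<in> S; b \<in> S; c \<in> S\<rbrakk> \<Longrightarrow> (a \<cdot> b) \<cdot> c = (c \<cdot> b) \<cdot> a"

definition left_identity :: "'a set \<Rightarrow> ('a \<Rightarrow> 'a \<Rightarrow> 'a) \<Rightarrow> 'a \<Rightarrow> bool" where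
  "left_identity S f e \<longleftrightarrow> e \<in> S \<and> (\<forall>a\<in>S. f e a = a)"

definition intra_regular :: "'a set \<Rightarrow> ('a \<Rightarrow> 'a \<Rightarrow> 'a) \<Rightarrow> bool" where
  "intra_regular S f \<longleftrightarrow> (\<forall>a\<in>S. \<exists>x\<in>S. \<exists>y\<in>S. a = f (f x (f a a)) y)"

(* A pair A = (mu, gamma) of total functions; only the values on the carrier S matter,
   and every condition below is relativised to S. *)
type_synonym 'a fuzzy_pair = "('a \<Rightarrow> real) \<times> ('a \<Rightarrow> real)"

abbreviation mu :: "'a fuzzy_pair \<Rightarrow> 'a \<Rightarrow> real" where
  "mu A \<equiv> fst A"

abbreviation gam :: "'a fuzzy_pair \<Rightarrow> 'a \<Rightarrow> real" where
  "gam A \<equiv> snd A"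

definition IFS :: "'a set \<Rightarrow> 'a fuzzy_pair \<Rightarrow> bool" where
  "IFS S A \<longleftrightarrow> (\<forall>x\<in>S. mu A x \<in> {0..1} \<and> gam A x \<in> {0..1} \<and>
     0 \<le> mu A x + gam A x \<and> mu A x + gam A x \<le> 1)"

definition IF_left_ideal ::
  "'a set \<Rightarrow> ('a \<Rightarrow> 'a \<Rightarrow> 'a) \<Rightarrow> 'a fuzzy_pair \<Rightarrow> bool" where
  "IF_left_ideal S f A \<longleftrightarrow> IFS S A \<and>
     (\<forall>x\<in>S. \<forall>y\<in>S. mu A (f x y) \<ge> mu A y \<and> gam A (f x y) \<le> gam A y)"

definition IF_right_ideal ::
  "'a set \<Rightarrow> ('a \<Rightarrow> 'a \<Rightarrow> 'a) \<Rightarrow> 'a fuzzy_pair \<Rightarrow> bool" where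
  "IF_right_ideal S f A \<longleftrightarrow> IFS S A \<and>
     (\<forall>x\<in>S. \<forall>y\<in>S. mu A (f x y) \<ge> mu A x \<and> gam A (f x y) \<le> gam A x)"

definition IF_two_sided_ideal ::
  "'a set \<Rightarrow> ('a \<Rightarrow> 'a \<Rightarrow> 'a) \<Rightarrow> 'a fuzzy_pair \<Rightarrow> bool" where
  "IF_two_sided_ideal S f A \<longleftrightarrow> IF_left_ideal S f A \<and> IF_right_ideal S f A"

definition IF_AG_subgroupoid ::
  "'a set \<Rightarrow> ('a \<Rightarrow> 'a \<Rightarrow> 'a) \<Rightarrow> 'a fuzzy_pair \<Rightarrow> bool" where
  "IF_AG_subgroupoid S f A \<longleftrightarrow> IFS S A \<and>
     (\<forall>x\<in>S. \<forall>y\<in>S. mu A (f x y) \<ge> min (mu A x) (mu A y) \<and>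
                      gam A (f x y) \<le> max (gam A x) (gam A y))"

definition IF_12_ideal ::
  "'a set \<Rightarrow> ('a \<Rightarrow> 'a \<Rightarrow> 'a) \<Rightarrow> 'a fuzzy_pair \<Rightarrow> bool" where
  "IF_12_ideal S f A \<longleftrightarrow> IF_AG_subgroupoid S f A \<and>
     (\<forall>x\<in>S. \<forall>w\<in>S. \<forall>y\<in>S. \<forall>z\<in>S.
        mu A (f (f x w) (f y z)) \<ge> Min {mu A x, mu A y, mu A z} \<and>
        gam A (f (f x w) (f y z)) \<le> Max {gam A x, gam A y, gam A z})"

end

theory Submission
  imports Defs
begin

text \<open>The point is that in an intra-regular AG-groupoid with left identity both
  \<open>S a\<close> and \<open>a S\<close> are contained in \<open>S a\<^sup>2\<close>, while \<open>S a\<^sup>2 = (S a) a \<subseteq> (a\<^sup>2 S) a = (a S) a\<^sup>2\<close>.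
  Hence every product with a factor \<open>a\<close> has the form \<open>(a w)(a a)\<close>, and the \<open>(1,2)\<close>-ideal
  inequality at \<open>x = y = z = a\<close> yields both ideal inequalities.\<close>

locale ag_groupoid_left_id = ag_groupoid +
  fixes e :: 'a
  assumes left_id: "left_identity S f e"
begin

lemma e_closed: "e \<in> S" and e_left: "a \<in> S \<Longrightarrow> e \<cdot> a = a"
  using left_id by (auto simp: left_identity_def)

text \<open>Three uses of the left invertive law: (ab)(cd) = ((cd)b)a = ((bd)c)a = (ac)(bd).\<close>

lemma medial:
  assumes "a \<in> S" "b \<in> S" "c \<in> S" "d \<in> S"
  shows "(a \<cdot> b) \<cdot> (c \<cdot> d) = (a \<cdot> c) \<cdot> (b \<cdot> d)"
  using assms by (metis closed left_invertive)

lemma left_commute: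
  assumes "a \<in> S" "b \<in> S" "c \<in> S"
  shows "a \<cdot> (b \<cdot> c) = b \<cdot> (a \<cdot> c)"
  using assms medial[of e a b c] by (simp add: e_left e_closed closed)

text \<open>Chain: (ab)(cd) = c((ab)d) = c((db)a) = (db)(ca) = (dc)(ba), by
  \<open>left_commute\<close>, the left invertive law, \<open>left_commute\<close> and
  \<open>medial\<close>.\<close>

lemma reverse_product:
  assumes "a \<in> S" "b \<in> S" "c \<in> S" "d \<in> S"
  shows "(a \<cdot> b) \<cdot> (c \<cdot> d) = (d \<cdot> c) \<cdot> (b \<cdot> a)"
  using assms by (metis closed left_invertive left_commute medial)

text \<open>Reversing (ev)(aa) fixes the square but turns ev into ve, which may differ from v
  because e is only a left identity.\<close>

lemma mult_square_commute:
  assumes "a \<in> S" "v \<in> S"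
  shows "v \<cdot> (a \<cdot> a) = (a \<cdot> a) \<cdot> (v \<cdot> e)"
  using assms reverse_product[of e v a a] by (simp add: e_left e_closed)

lemma square_mult_commute:
  assumes "a \<in> S" "v \<in> S"
  shows "(a \<cdot> a) \<cdot> v = (v \<cdot> e) \<cdot> (a \<cdot> a)"
  using assms reverse_product[of a a e v] by (simp add: e_left e_closed)

text \<open>A substitute for associativity: two successive left multiplications of a merge into one.
  The chain is s(ua) = (es)(ua) = (au)(se) = ((se)u)a.\<close>

lemma mult_mult:
  assumes "a \<in> S" "s \<in> S" "u \<in> S"
  shows "s \<cdot> (u \<cdot> a) = ((s \<cdot> e) \<cdot> u) \<cdot> a"
  using assms reverse_product[of e s u a] left_invertive[of a u "s \<cdot> e"]
  by (simp add: e_left e_closed closed)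

lemma intra_regular_square_factor:
  assumes "intra_regular S f" "a \<in> S"
  obtains t where "t \<in> S" "a = (a \<cdot> a) \<cdot> t"
proof -
  obtain x y where xy: "x \<in> S" "y \<in> S" and a: "a = (x \<cdot> (a \<cdot> a)) \<cdot> y"
    using assms by (auto simp: intra_regular_def)
  \<comment> \<open>This is the multiplier that \<open>mult_mult\<close> produces when y(xa) is
    written as a single left multiple of a.\<close>
  let ?t = "(y \<cdot> e) \<cdot> x"
  have t: "?t \<in> S" using xy by (simp add: closed e_closed)
  have "a = (a \<cdot> (x \<cdot> a)) \<cdot> y" using a xy assms by (simp add: left_commute)
  also have "\<dots> = (y \<cdot> (x \<cdot> a)) \<cdot> a" using xy assms by (simp add: closed left_invertive)
  also have "\<dots> = (?t \<cdot> a) \<cdot> a" using xy assms by (simp add: mult_mult)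
  also have "\<dots> = (a \<cdot> a) \<cdot> ?t" using assms t by (simp add: left_invertive)
  finally show thesis using t that by blast
qed

lemma intra_regular_left_multiple:
  assumes "intra_regular S f" "a \<in> S" "s \<in> S"
  obtains v where "v \<in> S" "s \<cdot> a = v \<cdot> (a \<cdot> a)"
proof -
  obtain t where t: "t \<in> S" "a = (a \<cdot> a) \<cdot> t"
    using assms intra_regular_square_factor by blast
  \<comment> \<open>Only the factor a of sa is expanded; with the square on the right,
    \<open>mult_mult\<close> applies to aa in place of a.\<close>
  have "s \<cdot> a = s \<cdot> ((t \<cdot> e) \<cdot> (a \<cdot> a))" using t assms square_mult_commute by metis
  also have "\<dots> = ((s \<cdot> e) \<cdot> (t \<cdot> e)) \<cdot> (a \<cdot> a)"
    using t assms by (intro mult_mult) (auto intro: closed e_closed)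
  finally show thesis using that t assms by (meson closed e_closed)
qed

lemma intra_regular_right_multiple:
  assumes "intra_regular S f" "a \<in> S" "s \<in> S"
  obtains v where "v \<in> S" "a \<cdot> s = v \<cdot> (a \<cdot> a)"
proof -
  obtain t where t: "t \<in> S" "a = (a \<cdot> a) \<cdot> t"
    using assms intra_regular_square_factor by blast
  have "a \<cdot> s = (s \<cdot> t) \<cdot> (a \<cdot> a)"
    using t assms left_invertive[of "a \<cdot> a" t s] by (simp add: closed)
  then show thesis using that t assms by (meson closed)
qed

lemma intra_regular_square_multiple:
  assumes "intra_regular S f" "a \<in> S" "v \<in> S"
  obtains w where "w \<in> S" "v \<cdot> (a \<cdot> a) = (a \<cdot> w) \<cdot> (a \<cdot> a)"
proof -
  \<comment> \<open>Since v(aa) = ((ve)a)a, expanding the inner product creates a third a. The left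
    invertive law then exchanges the new square with the outer a, so w = ue.\<close>
  obtain u where u: "u \<in> S" "(v \<cdot> e) \<cdot> a = u \<cdot> (a \<cdot> a)"
    using intra_regular_left_multiple assms closed e_closed by metis
  have "v \<cdot> (a \<cdot> a) = ((v \<cdot> e) \<cdot> a) \<cdot> a" using assms by (simp add: mult_mult)
  also have "\<dots> = ((a \<cdot> a) \<cdot> (u \<cdot> e)) \<cdot> a" using u assms by (simp add: mult_square_commute)
  also have "\<dots> = (a \<cdot> (u \<cdot> e)) \<cdot> (a \<cdot> a)"
    using u assms by (intro left_invertive) (auto intro: closed e_closed)
  finally show thesis using that u by (meson closed e_closed)
qed

lemma IF_12_ideal_imp_two_sided:
  assumes "intra_regular S f" "IF_12_ideal S f A"
  shows "IF_two_sided_ideal S f A"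
proof -
  have mono: "mu A (v \<cdot> (a \<cdot> a)) \<ge> mu A a \<and> gam A (v \<cdot> (a \<cdot> a)) \<le> gam A a"
    if v: "v \<in> S" and a: "a \<in> S" for a v
  proof -
    obtain w where w: "w \<in> S" "v \<cdot> (a \<cdot> a) = (a \<cdot> w) \<cdot> (a \<cdot> a)"
      using assms(1) v a intra_regular_square_multiple by blast
    have "mu A ((a \<cdot> w) \<cdot> (a \<cdot> a)) \<ge> Min {mu A a, mu A a, mu A a}
        \<and> gam A ((a \<cdot> w) \<cdot> (a \<cdot> a)) \<le> Max {gam A a, gam A a, gam A a}"
      using assms(2) a w(1) unfolding IF_12_ideal_def by blast
    then show ?thesis using w(2) by simp
  qed
  have "mu A (s \<cdot> a) \<ge> mu A a \<and> gam A (s \<cdot> a) \<le> gam A a"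
    and "mu A (a \<cdot> s) \<ge> mu A a \<and> gam A (a \<cdot> s) \<le> gam A a"
    if "s \<in> S" "a \<in> S" for s a
    using that mono intra_regular_left_multiple[OF assms(1)]
      intra_regular_right_multiple[OF assms(1)] by metis+
  moreover have "IFS S A"
    using assms(2) by (simp add: IF_12_ideal_def IF_AG_subgroupoid_def)
  ultimately show ?thesis
    by (auto simp: IF_two_sided_ideal_def IF_left_ideal_def IF_right_ideal_def)
qed

end

text \<open>Going from x to xw and then to (xw)(yz), the right ideal inequality bounds both values
  by those at x, and these already dominate the minimum and are dominated by the maximum.\<close>

lemma (in ag_groupoid) IF_two_sided_imp_12_ideal:
  assumes "IF_two_sided_ideal S f A"
  shows "IF_12_ideal S f A"
proof -
  have A: "IFS S A"
    using assms by (simp add: IF_two_sided_ideal_def IF_right_ideal_def)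
  have r: "mu A x \<le> mu A (x \<cdot> y)" "gam A (x \<cdot> y) \<le> gam A x" if "x \<in> S" "y \<in> S" for x y
    using assms that by (auto simp: IF_two_sided_ideal_def IF_right_ideal_def)
  have "mu A x \<le> mu A ((x \<cdot> w) \<cdot> (y \<cdot> z))" "gam A ((x \<cdot> w) \<cdot> (y \<cdot> z)) \<le> gam A x"
    if "x \<in> S" "w \<in> S" "y \<in> S" "z \<in> S" for x w y z
    using that r[of x w] r[of "x \<cdot> w" "y \<cdot> z"] by (auto simp: closed)
  then show ?thesis
    using A r
    by (auto simp: IF_12_ideal_def IF_AG_subgroupoid_def min_le_iff_disj le_max_iff_disj)
qed

theorem theorem14:
  fixes S :: "'a set" and f :: "'a \<Rightarrow> 'a \<Rightarrow> 'a"
    and A :: "('a \<Rightarrow> real) \<times> ('a \<Rightarrow> real)"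
  assumes "ag_groupoid S f"
    and "\<exists>e. left_identity S f e"
    and "intra_regular S f"
    and "IFS S A"
  shows "IF_two_sided_ideal S f A \<longleftrightarrow> IF_12_ideal S f A"
proof -
  obtain e where e: "left_identity S f e" using assms(2) by blast
  then interpret ag_groupoid_left_id S f e
    using assms(1) by (simp add: ag_groupoid_left_id_def ag_groupoid_left_id_axioms_def)
  show ?thesis
    using IF_two_sided_imp_12_ideal IF_12_ideal_imp_two_sided[OF assms(3)] by blast
qed

end
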